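(* Let $F$ be a finitely generated free group, let $\phi: F \to F$ be an endomorphism, and let $H$ be a finite-index subgroup of $F$ that is invariant under $\phi$ (that is, $\phi(H) \subset H$). Then $\Lambda(\phi) \subset \Lambda(\phi|_H)$, where $\phi|_H: H \to H$ is the restriction of $\phi$.
   Context: For an endomorphism $\psi: G \to G$ of a free group $G$ of finite rank, an eigenvalue of $\psi$ means an eigenvalue of the induced $\mathbb{C}$-linear map $\psi^{\rm ab} \otimes 1: G/[G,G] \otimes_{\mathbb{Z}} \mathbb{C} \to G/[G,G] \otimes_{\mathbb{Z}} \mathbb{C}$, where $\psi^{\rm ab}$ is the endomorphism of the abelianization $G/[G,G]$ induced by $\psi$. The set of nonzero eigenvalues of $\psi$ is denoted $\Lambda(\psi)$. (A finite-index subgroup $H$ of a finitely generated free group is itself free of finite rank, so $\Lambda(\phi|_H)$ is defined in the same way, using $H/[H,H] \otimes_{\mathbb{Z}} \mathbb{C}$.) *)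

theory Defs
  imports Complex_Main "HOL-Algebra.Algebra" "HOL-Algebra.Free_Abelian_Groups"
begin

section \<open>Free groups and finite generation\<close>

text \<open>A letter \<open>(True, x)\<close> stands for \<open>x\<close> and \<open>(False, x)\<close> for its inverse.\<close>

definition word_value :: "('a, 'b) monoid_scheme \<Rightarrow> (bool \<times> 'a) list \<Rightarrow> 'a" where
  "word_value G w =
     foldr (\<lambda>(b, x) g. (if b then x else inv\<^bsub>G\<^esub> x) \<otimes>\<^bsub>G\<^esub> g) w \<one>\<^bsub>G\<^esub>"

definition reduced_words :: "'a set \<Rightarrow> (bool \<times> 'a) list set" where
  "reduced_words S =
     {w. set w \<subseteq> UNIV \<times> S \<and>
         successively (\<lambda>(b, x) (c, y). \<not> (x = y \<and> b \<noteq> c)) w}"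

definition free_basis :: "('a, 'b) monoid_scheme \<Rightarrow> 'a set \<Rightarrow> bool" where
  "free_basis G S \<longleftrightarrow>
     S \<subseteq> carrier G \<and> bij_betw (word_value G) (reduced_words S) (carrier G)"

definition free_group :: "('a, 'b) monoid_scheme \<Rightarrow> bool" where
  "free_group G \<longleftrightarrow> group G \<and> (\<exists>S. free_basis G S)"

definition finitely_generated :: "('a, 'b) monoid_scheme \<Rightarrow> bool" where
  "finitely_generated G \<longleftrightarrow>
     (\<exists>S. finite S \<and> S \<subseteq> carrier G \<and> generate G S = carrier G)"

section \<open>Maps induced on quotients; the abelianization\<close>

text \<open>If \<open>f : G \<rightarrow> H\<close> is a homomorphism mapping the normal subgroup \<open>M\<close> of \<open>G\<close> into the
  normal subgroup \<open>N\<close> of \<open>H\<close>, then \<open>quotient_map H N f\<close> sends the coset \<open>M g\<close> to \<open>N f(g)\<close>;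
  see \<open>quotient_map_coset\<close> below.\<close>

definition quotient_map ::
  "('b, 'n) monoid_scheme \<Rightarrow> 'b set \<Rightarrow> ('a \<Rightarrow> 'b) \<Rightarrow> 'a set \<Rightarrow> 'b set" where
  "quotient_map H N f C = N <#>\<^bsub>H\<^esub> (f ` C)"

lemma quotient_map_coset:
  assumes f: "f \<in> hom G H" and "group G" and "group H"
    and M: "subgroup M G" and N: "subgroup N H" and MN: "f ` M \<subseteq> N"
    and g: "g \<in> carrier G"
  shows "quotient_map H N f (M #>\<^bsub>G\<^esub> g) = N #>\<^bsub>H\<^esub> f g"
proof -
  interpret G: group G by fact
  interpret H: group H by fact
  have Mc: "M \<subseteq> carrier G" and Nc: "N \<subseteq> carrier H"
    using M N by (auto dest: subgroup.subset)
  have fg: "f g \<in> carrier H"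
    using f g by (auto simp: hom_def)
  have fm: "f (m \<otimes>\<^bsub>G\<^esub> g) = f m \<otimes>\<^bsub>H\<^esub> f g" if "m \<in> M" for m
    using that Mc f g by (auto simp: hom_def)
  have "n \<otimes>\<^bsub>H\<^esub> f (m \<otimes>\<^bsub>G\<^esub> g) \<in> N #>\<^bsub>H\<^esub> f g" if n: "n \<in> N" and m: "m \<in> M" for n m
  proof -
    have "f m \<in> N" using MN m by auto
    then have "n \<otimes>\<^bsub>H\<^esub> f m \<in> N" using n N by (auto intro: subgroup.m_closed)
    moreover have "n \<otimes>\<^bsub>H\<^esub> f (m \<otimes>\<^bsub>G\<^esub> g) = (n \<otimes>\<^bsub>H\<^esub> f m) \<otimes>\<^bsub>H\<^esub> f g"
      using fm [OF m] n \<open>f m \<in> N\<close> Nc fg by (simp add: H.m_assoc subsetD)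
    ultimately show ?thesis by (auto simp: r_coset_def)
  qed
  moreover have "n \<otimes>\<^bsub>H\<^esub> f g \<in> quotient_map H N f (M #>\<^bsub>G\<^esub> g)" if "n \<in> N" for n
  proof -
    have "\<one>\<^bsub>G\<^esub> \<otimes>\<^bsub>G\<^esub> g \<in> M #>\<^bsub>G\<^esub> g"
      using M by (auto simp: r_coset_def subgroup.one_closed)
    then show ?thesis
      using that g by (auto simp: quotient_map_def set_mult_def)
  qed
  ultimately show ?thesis
    by (auto simp: quotient_map_def set_mult_def r_coset_def)
qed

definition abelianization :: "('a, 'b) monoid_scheme \<Rightarrow> 'a set monoid" where
  "abelianization G = G Mod derived G (carrier G)"

definition abelianization_map ::
  "('a, 'b) monoid_scheme \<Rightarrow> ('a \<Rightarrow> 'a) \<Rightarrow> 'a set \<Rightarrow> 'a set" where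
  "abelianization_map G \<psi> = quotient_map G (derived G (carrier G)) \<psi>"

lemma derived_image_subset:
  assumes "group G" and "\<psi> \<in> hom G G"
  shows "\<psi> ` derived G (carrier G) \<subseteq> derived G (carrier G)"
proof -
  interpret group_hom G G \<psi>
    using assms by (simp add: group_hom_def group_hom_axioms_def)
  have "\<psi> ` carrier G \<subseteq> carrier G" by auto
  then show ?thesis
    using derived_img [of "carrier G"] G.mono_derived by (metis order_refl)
qed

lemma abelianization_map_coset:
  assumes "group G" and "\<psi> \<in> hom G G" and "g \<in> carrier G"
  shows "abelianization_map G \<psi> (derived G (carrier G) #>\<^bsub>G\<^esub> g) =
    derived G (carrier G) #>\<^bsub>G\<^esub> \<psi> g"
  unfolding abelianization_map_def
  using assms by (intro quotient_map_coset derived_image_subset group.derived_is_subgroup) auto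

lemma comm_group_abelianization:
  assumes "group G"
  shows "comm_group (abelianization G)"
  unfolding abelianization_def by (rule group.derived_quot_is_comm_group [OF assms])

section \<open>Tensor products over the integers\<close>

text \<open>Abelian groups are written multiplicatively, except that \<^const>\<open>free_Abelian_group\<close>
  is carried by the additive type of finitely supported integer-valued functions.\<close>

definition tensor_relations ::
  "('a, 'm) monoid_scheme \<Rightarrow> ('b, 'n) monoid_scheme \<Rightarrow> ('a \<times> 'b \<Rightarrow>\<^sub>0 int) set" where
  "tensor_relations A B =
     {frag_of (a \<otimes>\<^bsub>A\<^esub> a', b) - frag_of (a, b) - frag_of (a', b) | a a' b.
        a \<in> carrier A \<and> a' \<in> carrier A \<and> b \<in> carrier B} \<union>
     {frag_of (a, b \<otimes>\<^bsub>B\<^esub> b') - frag_of (a, b) - frag_of (a, b') | a b b'.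
        a \<in> carrier A \<and> b \<in> carrier B \<and> b' \<in> carrier B}"

definition tensor_kernel ::
  "('a, 'm) monoid_scheme \<Rightarrow> ('b, 'n) monoid_scheme \<Rightarrow> ('a \<times> 'b \<Rightarrow>\<^sub>0 int) set" where
  "tensor_kernel A B =
     generate (free_Abelian_group (carrier A \<times> carrier B)) (tensor_relations A B)"

lemma tensor_relations_subset:
  fixes A :: "('a, 'm) monoid_scheme" and B :: "('b, 'n) monoid_scheme"
  assumes "group A" and "group B"
  shows "tensor_relations A B \<subseteq> carrier (free_Abelian_group (carrier A \<times> carrier B))"
proof -
  interpret A: group A by fact
  interpret B: group B by fact
  have sub: "Poly_Mapping.keys (x - y - z) \<subseteq> S"
    if "Poly_Mapping.keys x \<subseteq> S" "Poly_Mapping.keys y \<subseteq> S" "Poly_Mapping.keys z \<subseteq> S"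
    for x y z :: "'a \<times> 'b \<Rightarrow>\<^sub>0 int" and S
    using that keys_diff [of "x - y" z] keys_diff [of x y] by blast
  show ?thesis
  proof
    fix r assume "r \<in> tensor_relations A B"
    then show "r \<in> carrier (free_Abelian_group (carrier A \<times> carrier B))"
      unfolding tensor_relations_def carrier_free_Abelian_group_iff
      by (elim UnE CollectE exE conjE) (simp_all add: sub)
  qed
qed

lemma subgroup_tensor_kernel:
  assumes "group A" and "group B"
  shows "subgroup (tensor_kernel A B) (free_Abelian_group (carrier A \<times> carrier B))"
  unfolding tensor_kernel_def
  by (rule group.generate_is_subgroup [OF group_free_Abelian_group tensor_relations_subset [OF assms]])

lemma frag_extend_in_hom:
  assumes "\<And>s. s \<in> S \<Longrightarrow> p s \<in> carrier (free_Abelian_group T)"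
  shows "frag_extend p \<in> hom (free_Abelian_group S) (free_Abelian_group T)"
  using assms keys_frag_extend [of p] by (fastforce simp: hom_def frag_extend_add)

lemma frag_extend_tensor_kernel:
  assumes "group A" and "group B" and "group A'" and "group B'"
    and f: "f \<in> hom A A'" and h: "h \<in> hom B B'"
  shows "frag_extend (\<lambda>(a, b). frag_of (f a, h b)) ` tensor_kernel A B \<subseteq> tensor_kernel A' B'"
proof -
  let ?E = "frag_extend (\<lambda>(a, b). frag_of (f a, h b))"
  let ?G = "free_Abelian_group (carrier A \<times> carrier B)"
  let ?G' = "free_Abelian_group (carrier A' \<times> carrier B')"
  have fc: "f a \<in> carrier A'" if "a \<in> carrier A" for a using f that by (auto simp: hom_def)
  have hc: "h b \<in> carrier B'" if "b \<in> carrier B" for b using h that by (auto simp: hom_def)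
  have E: "?E \<in> hom ?G ?G'"
    by (rule frag_extend_in_hom) (auto simp: fc hc)
  interpret E: group_hom ?G ?G' ?E
    by (simp add: group_hom_def group_hom_axioms_def E)
  have rel: "?E ` tensor_relations A B \<subseteq> tensor_relations A' B'"
  proof
    fix y assume "y \<in> ?E ` tensor_relations A B"
    then obtain r where r: "r \<in> tensor_relations A B" and y: "y = ?E r" by auto
    from r consider
      a a' b where "a \<in> carrier A" "a' \<in> carrier A" "b \<in> carrier B"
        "r = frag_of (a \<otimes>\<^bsub>A\<^esub> a', b) - frag_of (a, b) - frag_of (a', b)"
      | a b b' where "a \<in> carrier A" "b \<in> carrier B" "b' \<in> carrier B"
        "r = frag_of (a, b \<otimes>\<^bsub>B\<^esub> b') - frag_of (a, b) - frag_of (a, b')"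
      unfolding tensor_relations_def by blast
    then show "y \<in> tensor_relations A' B'"
    proof cases
      case 1
      then have "y = frag_of (f a \<otimes>\<^bsub>A'\<^esub> f a', h b) - frag_of (f a, h b) - frag_of (f a', h b)"
        using f by (simp add: y frag_extend_diff hom_mult)
      with 1 fc hc show ?thesis unfolding tensor_relations_def by blast
    next
      case 2
      then have "y = frag_of (f a, h b \<otimes>\<^bsub>B'\<^esub> h b') - frag_of (f a, h b) - frag_of (f a, h b')"
        using h by (simp add: y frag_extend_diff hom_mult)
      with 2 fc hc show ?thesis unfolding tensor_relations_def by blast
    qed
  qed
  show ?thesis
    unfolding tensor_kernel_def
    using E.generate_img [OF tensor_relations_subset [OF assms(1,2)]]
      group.mono_generate [OF group_free_Abelian_group rel]
    by metis
qed

definition tensor ::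
  "('a, 'm) monoid_scheme \<Rightarrow> ('b, 'n) monoid_scheme \<Rightarrow> ('a \<times> 'b \<Rightarrow>\<^sub>0 int) set monoid" where
  "tensor A B = free_Abelian_group (carrier A \<times> carrier B) Mod tensor_kernel A B"

definition pure_tensor ::
  "('a, 'm) monoid_scheme \<Rightarrow> ('b, 'n) monoid_scheme \<Rightarrow> 'a \<Rightarrow> 'b \<Rightarrow> ('a \<times> 'b \<Rightarrow>\<^sub>0 int) set" where
  "pure_tensor A B a b =
     tensor_kernel A B #>\<^bsub>free_Abelian_group (carrier A \<times> carrier B)\<^esub> frag_of (a, b)"

text \<open>The map \<open>f \<otimes> h\<close> into the tensor product of \<open>A\<close> and \<open>B\<close>;
  see \<open>tensor_map_pure\<close> below.\<close>

definition tensor_map ::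
  "('c, 'm) monoid_scheme \<Rightarrow> ('d, 'n) monoid_scheme \<Rightarrow> ('a \<Rightarrow> 'c) \<Rightarrow> ('b \<Rightarrow> 'd) \<Rightarrow>
   ('a \<times> 'b \<Rightarrow>\<^sub>0 int) set \<Rightarrow> ('c \<times> 'd \<Rightarrow>\<^sub>0 int) set" where
  "tensor_map A B f h =
     quotient_map (free_Abelian_group (carrier A \<times> carrier B)) (tensor_kernel A B)
       (frag_extend (\<lambda>(a, b). frag_of (f a, h b)))"

lemma tensor_map_coset:
  assumes "group A" and "group B" and "group A'" and "group B'"
    and f: "f \<in> hom A A'" and h: "h \<in> hom B B'"
    and x: "x \<in> carrier (free_Abelian_group (carrier A \<times> carrier B))"
  shows "tensor_map A' B' f h
           (tensor_kernel A B #>\<^bsub>free_Abelian_group (carrier A \<times> carrier B)\<^esub> x) =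
         tensor_kernel A' B' #>\<^bsub>free_Abelian_group (carrier A' \<times> carrier B')\<^esub>
           frag_extend (\<lambda>(a, b). frag_of (f a, h b)) x"
  unfolding tensor_map_def
proof (rule quotient_map_coset)
  show "frag_extend (\<lambda>(a, b). frag_of (f a, h b))
      \<in> hom (free_Abelian_group (carrier A \<times> carrier B))
          (free_Abelian_group (carrier A' \<times> carrier B'))"
    using f h by (intro frag_extend_in_hom) (auto simp: hom_def)
qed (use assms in \<open>auto intro: subgroup_tensor_kernel simp: frag_extend_tensor_kernel simp del: carrier_free_Abelian_group_iff\<close>)

lemma tensor_map_pure:
  assumes "group A" and "group B" and "group A'" and "group B'"
    and "f \<in> hom A A'" and "h \<in> hom B B'" and "a \<in> carrier A" and "b \<in> carrier B"
  shows "tensor_map A' B' f h (pure_tensor A B a b) = pure_tensor A' B' (f a) (h b)"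
  using tensor_map_coset [OF assms(1-6), of "frag_of (a, b)"] assms(7,8)
  by (simp add: pure_tensor_def)

section \<open>Complexification and eigenvalues\<close>

definition complex_group :: "complex monoid" where
  "complex_group = \<lparr>carrier = UNIV, monoid.mult = (+), one = 0\<rparr>"

definition complex_ring :: "complex ring" where
  "complex_ring =
     \<lparr>carrier = UNIV, monoid.mult = (*), one = 1, ring.zero = 0, ring.add = (+)\<rparr>"

lemma comm_group_complex_group: "comm_group complex_group"
  by (rule comm_groupI) (auto simp: complex_group_def intro: exI [of _ "- _"] add.left_inverse)

lemma cring_complex_ring: "cring complex_ring"
proof (rule cringI)
  show "abelian_group complex_ring"
    by (rule abelian_groupI) (auto simp: complex_ring_def intro: exI [of _ "- _"] add.left_inverse)
  show "comm_monoid complex_ring"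
    by (rule comm_monoidI) (auto simp: complex_ring_def)
qed (auto simp: complex_ring_def algebra_simps)

text \<open>The complex vector space obtained from an abelian group by tensoring with the complex
  numbers over the integers. The library's module record extends the ring record; its
  multiplication and unit fields are irrelevant to modules and left undefined.\<close>

definition complexification ::
  "('a, 'm) monoid_scheme \<Rightarrow> (complex, ('a \<times> complex \<Rightarrow>\<^sub>0 int) set) module" where
  "complexification A =
     \<lparr>carrier = carrier (tensor A complex_group),
      monoid.mult = undefined, one = undefined,
      ring.zero = \<one>\<^bsub>tensor A complex_group\<^esub>,
      ring.add = monoid.mult (tensor A complex_group),
      smult = (\<lambda>c. tensor_map A complex_group (\<lambda>a. a) (\<lambda>z. c * z))\<rparr>"

lemma module_complexification:
  fixes A :: "('a, 'm) monoid_scheme"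
  assumes "comm_group A"
  shows "module complex_ring (complexification A)"
proof -
  interpret A: comm_group A by fact
  interpret C: comm_group complex_group by (rule comm_group_complex_group)
  define FA where "FA = free_Abelian_group (carrier A \<times> carrier complex_group)"
  define K where "K = tensor_kernel A complex_group"
  let ?M = "complexification A"
  have FA: "comm_group FA"
    unfolding FA_def by (rule abelian_free_Abelian_group)
  interpret FA: comm_group FA by (rule FA)
  have K: "subgroup K FA"
    unfolding K_def FA_def by (rule subgroup_tensor_kernel) unfold_locales
  interpret K: normal K FA by (rule FA.subgroup_imp_normal [OF K])
  have T: "tensor A complex_group = FA Mod K"
    by (simp add: tensor_def FA_def K_def)
  interpret T: comm_group "FA Mod K" by (rule FA.abelian_FactGroup [OF K])
  have carr: "carrier ?M = (\<lambda>x. K #>\<^bsub>FA\<^esub> x) ` carrier FA"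
    by (simp add: complexification_def T carrier_FactGroup)
  have mulc: "(*) c \<in> hom complex_group complex_group" for c
    by (auto simp: hom_def complex_group_def algebra_simps)
  have ida: "(\<lambda>a. a) \<in> hom A A" by (auto simp: hom_def)
  have addM: "(K #>\<^bsub>FA\<^esub> x) \<oplus>\<^bsub>?M\<^esub> (K #>\<^bsub>FA\<^esub> y) = K #>\<^bsub>FA\<^esub> (x + y)"
    if "x \<in> carrier FA" "y \<in> carrier FA" for x y
    using K.rcos_sum [OF that] by (simp add: complexification_def T) (simp add: FA_def)
  have sm: "c \<odot>\<^bsub>?M\<^esub> (K #>\<^bsub>FA\<^esub> x) = K #>\<^bsub>FA\<^esub> frag_extend (\<lambda>(a, z). frag_of (a, c * z)) x"
    if "x \<in> carrier FA" for c x
    using tensor_map_coset [OF A.is_group C.is_group A.is_group C.is_group ida mulc, of x c] that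
    by (simp add: complexification_def FA_def K_def)
  have ec: "frag_extend (\<lambda>(a, z). frag_of (a, c * z)) x \<in> carrier FA" if "x \<in> carrier FA" for c x
  proof -
    have "frag_extend (\<lambda>(a, z). frag_of (a, c * z)) \<in> hom FA FA"
      unfolding FA_def by (rule frag_extend_in_hom) (auto simp: complex_group_def)
    then show ?thesis using that by (auto simp: hom_def)
  qed
  have Kdiff: "u - v \<in> K" if "u \<in> K" "v \<in> K" for u v
  proof -
    have v: "Poly_Mapping.keys v \<subseteq> carrier A \<times> carrier complex_group"
      using subgroup.mem_carrier [OF K that(2)] by (simp add: FA_def)
    have "u \<otimes>\<^bsub>FA\<^esub> inv\<^bsub>FA\<^esub> v \<in> K"
      using that by (intro subgroup.m_closed [OF K] subgroup.m_inv_closed [OF K])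
    then show ?thesis using v by (simp add: FA_def)
  qed
  have dist: "frag_extend (\<lambda>(a, z). frag_of (a, (c + d) * z)) x -
      (frag_extend (\<lambda>(a, z). frag_of (a, c * z)) x + frag_extend (\<lambda>(a, z). frag_of (a, d * z)) x) \<in> K"
    (is "?P x") if "x \<in> carrier FA" for c d x
  proof -
    have "Poly_Mapping.keys x \<subseteq> carrier A \<times> carrier complex_group"
      using that by (simp add: FA_def)
    then show ?thesis
    proof (induction x rule: frag_induction)
      case zero
      then show ?case using subgroup.one_closed [OF K] by (simp add: FA_def)
    next
      case (one s)
      obtain a z where s: "s = (a, z)" "a \<in> carrier A" using one by (cases s) auto
      have "frag_of (a, (c * z) \<otimes>\<^bsub>complex_group\<^esub> (d * z)) - frag_of (a, c * z) - frag_of (a, d * z)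
          \<in> tensor_relations A complex_group"
        using s unfolding tensor_relations_def by (auto simp: complex_group_def)
      then have "frag_of (a, c * z + d * z) - frag_of (a, c * z) - frag_of (a, d * z) \<in> K"
        unfolding K_def tensor_kernel_def by (auto simp: complex_group_def intro: generate.incl)
      then show ?case by (simp add: s algebra_simps)
    next
      case (diff p q)
      show ?case
        using Kdiff [OF diff] by (simp add: frag_extend_diff algebra_simps)
    qed
  qed
  have eqc: "K #>\<^bsub>FA\<^esub> x = K #>\<^bsub>FA\<^esub> y"
    if "x - y \<in> K" "x \<in> carrier FA" "y \<in> carrier FA" for x y
  proof -
    have "x \<in> K #>\<^bsub>FA\<^esub> y"
      using that(1) by (auto simp: r_coset_def FA_def intro!: bexI [of _ "x - y"])
    then show ?thesis
      using FA.repr_independence [OF _ that(3) K] by simp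
  qed
  have addc: "x + y \<in> carrier FA" if "x \<in> carrier FA" "y \<in> carrier FA" for x y
    using FA.m_closed [OF that] by (simp add: FA_def)
  show ?thesis
  proof (rule moduleI)
    show "cring complex_ring" by (rule cring_complex_ring)
    have inv: "\<exists>y\<in>carrier (FA Mod K). y \<otimes>\<^bsub>FA Mod K\<^esub> x = \<one>\<^bsub>FA Mod K\<^esub>"
      if "x \<in> carrier (FA Mod K)" for x
      using that T.l_inv T.inv_closed by blast
    show "abelian_group ?M"
      using T.m_closed T.one_closed T.m_assoc T.m_comm T.l_one inv
      by (intro abelian_groupI) (simp_all add: complexification_def T)
  next
    fix a x assume "x \<in> carrier ?M"
    then show "a \<odot>\<^bsub>?M\<^esub> x \<in> carrier ?M"
      by (auto simp: carr sm ec)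
  next
    fix a b x assume "x \<in> carrier ?M"
    then show "(a \<oplus>\<^bsub>complex_ring\<^esub> b) \<odot>\<^bsub>?M\<^esub> x = (a \<odot>\<^bsub>?M\<^esub> x) \<oplus>\<^bsub>?M\<^esub> (b \<odot>\<^bsub>?M\<^esub> x)"
      by (auto simp: carr sm ec addM complex_ring_def eqc [OF dist ec addc [OF ec ec]])
  next
    fix a x y assume "x \<in> carrier ?M" "y \<in> carrier ?M"
    then show "a \<odot>\<^bsub>?M\<^esub> (x \<oplus>\<^bsub>?M\<^esub> y) = (a \<odot>\<^bsub>?M\<^esub> x) \<oplus>\<^bsub>?M\<^esub> (a \<odot>\<^bsub>?M\<^esub> y)"
      by (auto simp: carr sm ec addM addc frag_extend_add)
  next
    fix a b x assume x: "x \<in> carrier ?M"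
    have "frag_extend (\<lambda>(r, z). frag_of (r, a * z)) (frag_extend (\<lambda>(r, z). frag_of (r, b * z)) u) =
        frag_extend (\<lambda>(r, z). frag_of (r, a * b * z)) u" for u :: "'a \<times> complex \<Rightarrow>\<^sub>0 int"
      using frag_extend_compose [of "\<lambda>(r, z). frag_of (r, a * z)" "\<lambda>(r, z). (r, b * z)" u]
      by (simp add: comp_def case_prod_unfold mult.assoc)
    with x show "(a \<otimes>\<^bsub>complex_ring\<^esub> b) \<odot>\<^bsub>?M\<^esub> x = a \<odot>\<^bsub>?M\<^esub> (b \<odot>\<^bsub>?M\<^esub> x)"
      by (auto simp: carr sm ec complex_ring_def)
  next
    fix x assume "x \<in> carrier ?M"
    moreover have "frag_extend (\<lambda>(r, z). frag_of (r, z)) u = u" for u :: "'a \<times> complex \<Rightarrow>\<^sub>0 int"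
      using frag_expansion [of u] by (simp add: case_prod_unfold)
    ultimately show "\<one>\<^bsub>complex_ring\<^esub> \<odot>\<^bsub>?M\<^esub> x = x"
      by (auto simp: carr sm complex_ring_def)
  qed
qed

definition complexification_map ::
  "('a, 'm) monoid_scheme \<Rightarrow> ('a \<Rightarrow> 'a) \<Rightarrow>
   ('a \<times> complex \<Rightarrow>\<^sub>0 int) set \<Rightarrow> ('a \<times> complex \<Rightarrow>\<^sub>0 int) set" where
  "complexification_map A f = tensor_map A complex_group f (\<lambda>z. z)"

definition eigenvalue_on :: "('c, 'v, 'm) module_scheme \<Rightarrow> ('v \<Rightarrow> 'v) \<Rightarrow> 'c \<Rightarrow> bool" where
  "eigenvalue_on V T c \<longleftrightarrow> (\<exists>v\<in>carrier V. v \<noteq> \<zero>\<^bsub>V\<^esub> \<and> T v = c \<odot>\<^bsub>V\<^esub> v)"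

definition nonzero_eigenvalues :: "('a, 'b) monoid_scheme \<Rightarrow> ('a \<Rightarrow> 'a) \<Rightarrow> complex set" where
  "nonzero_eigenvalues G \<psi> =
     {c. c \<noteq> 0 \<and>
         eigenvalue_on (complexification (abelianization G))
           (complexification_map (abelianization G) (abelianization_map G \<psi>)) c}"

end

theory Submission
  imports Defs "Jordan_Normal_Form.Missing_VectorSpace"
begin

text \<open>Write \<open>V\<close> and \<open>W\<close> for the complexified abelianizations of \<open>F\<close> and \<open>H\<close>. Every element of \<open>F\<close>
  has a positive power in \<open>H\<close>, so the inclusion induces a surjective linear map \<open>W \<rightarrow> V\<close>, and it
  intertwines the maps \<open>S\<close> on \<open>W\<close> and \<open>T\<close> on \<open>V\<close> induced by \<open>\<phi>\<close>. By Schreier's argument \<open>H\<close> is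
  finitely generated, so \<open>W\<close> is finite-dimensional. If \<open>c\<close> were not an eigenvalue of \<open>S\<close>, then
  \<open>S - c\<close> would be injective, hence surjective; so \<open>T - c\<close> would be surjective, hence injective,
  and \<open>c\<close> would not be an eigenvalue of \<open>T\<close>.\<close>

section \<open>Linear endomorphisms of finite-dimensional spaces\<close>

text \<open>Independence within \<open>N\<close> agrees with independence in \<open>V\<close>, so
  independent subsets of \<open>N\<close> have at most \<open>dim\<close> elements. Hence a maximal
  one exists, and it is a basis of \<open>N\<close>.\<close>

lemma (in vectorspace) subspace_fin_dim:
  assumes fd: "fin_dim" and N: "subspace K N V"
  shows "vectorspace.fin_dim K (vs N)"
proof -
  interpret N: vectorspace K "vs N" by (rule subspace_is_vs [OF N])
  have sub: "submodule K N V" using N by (rule is_module)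
  have NV: "N \<subseteq> carrier V" using sub by (rule submodule.subset)
  have small: "finite A \<and> card A \<le> dim" if "A \<subseteq> N \<and> N.lin_indpt A" for A
    using that li_le_dim [OF fd, of A] NV span_li_not_depend(2) [OF _ sub, of A] by auto
  have "{} \<subseteq> N \<and> N.lin_indpt {}"
    by (auto simp: N.lin_dep_def)
  then obtain A where A: "finite A" "maximal A (\<lambda>S. S \<subseteq> N \<and> N.lin_indpt S)"
    using maximal_exists [of "\<lambda>S. S \<subseteq> N \<and> N.lin_indpt S" dim "{}"] small by blast
  then have "N.basis A"
    by (intro N.max_li_is_basis) simp
  with A(1) show ?thesis
    unfolding N.fin_dim_def N.basis_def by blast
qed

text \<open>By rank-nullity with zero kernel, a basis of the image has \<open>V.dim\<close>
  elements. Being independent in \<open>V\<close>, it is already a basis of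
  \<open>V\<close>.\<close>

lemma linear_endomorphism_inj_imp_surj:
  assumes "linear_map K V V T" and fd: "vectorspace.fin_dim K V"
    and inj: "inj_on T (carrier V)"
  shows "T ` carrier V = carrier V"
proof -
  interpret linear_map K V V T by fact
  interpret I: vectorspace K "V.vs imT"
    by (rule V.subspace_is_vs [OF imT_is_subspace])
  have sub: "submodule K imT V" by (rule im_is_submodule)
  obtain B where B: "finite B" "I.basis B"
    using I.finite_basis_exists [OF V.subspace_fin_dim [OF fd imT_is_subspace]] by blast
  have BI: "B \<subseteq> imT" and spanB: "V.module.span B = imT"
    using B V.module.span_li_not_depend(1) [OF _ sub, of B] by (auto simp: I.basis_def)
  have li: "V.module.lin_indpt B"
    using B V.module.span_li_not_depend(2) [OF BI sub] by (auto simp: I.basis_def)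
  have BV: "B \<subseteq> carrier V"
    using BI submodule.subset [OF sub] by blast
  have "card B = V.dim"
    using I.dim_basis [OF B] rank_nullity [OF fd] inj_imp_dim_ker0 [OF inj] by simp
  then have "V.basis B"
    using V.dim_li_is_basis [OF fd B(1) BV li] by simp
  then show ?thesis
    using spanB by (simp add: V.basis_def im_def)
qed

text \<open>By rank-nullity with full image the kernel has dimension 0, so a finite basis of it is
  empty and spans only zero.\<close>

lemma linear_endomorphism_surj_imp_inj:
  assumes "linear_map K V V T" and fd: "vectorspace.fin_dim K V"
    and surj: "T ` carrier V = carrier V"
  shows "inj_on T (carrier V)"
proof -
  interpret linear_map K V V T by fact
  interpret N: vectorspace K "V.vs kerT"
    by (rule V.subspace_is_vs [OF kerT_is_subspace])
  obtain B where B: "finite B" "N.basis B"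
    using N.finite_basis_exists [OF V.subspace_fin_dim [OF fd kerT_is_subspace]] by blast
  have "card B = 0"
    using N.dim_basis [OF B] rank_nullity [OF fd] surj_imp_imT_carrier [OF surj] by simp
  then have "carrier (V.vs kerT) = {\<zero>\<^bsub>V\<^esub>}"
    using B N.span_empty by (simp add: N.basis_def)
  then show ?thesis by (rule Ke0_imp_inj)
qed

lemma linear_map_minus_scalar:
  assumes "linear_map K V V T" and c: "c \<in> carrier K"
  shows "linear_map K V V (\<lambda>v. T v \<ominus>\<^bsub>V\<^esub> c \<odot>\<^bsub>V\<^esub> v)"
proof -
  interpret linear_map K V V T by fact
  show ?thesis
  proof (unfold_locales, unfold module_hom_def, safe)
    fix v w assume "v \<in> carrier V" "w \<in> carrier V"
    then show "T (v \<oplus>\<^bsub>V\<^esub> w) \<ominus>\<^bsub>V\<^esub> c \<odot>\<^bsub>V\<^esub> (v \<oplus>\<^bsub>V\<^esub> w) =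
        T v \<ominus>\<^bsub>V\<^esub> c \<odot>\<^bsub>V\<^esub> v \<oplus>\<^bsub>V\<^esub> (T w \<ominus>\<^bsub>V\<^esub> c \<odot>\<^bsub>V\<^esub> w)"
      using c by (simp add: V.module.smult_r_distr V.module.M.minus_eq V.module.M.minus_add V.module.M.a_ac)
  next
    fix r v assume "r \<in> carrier K" "v \<in> carrier V"
    then show "T (r \<odot>\<^bsub>V\<^esub> v) \<ominus>\<^bsub>V\<^esub> c \<odot>\<^bsub>V\<^esub> (r \<odot>\<^bsub>V\<^esub> v) = r \<odot>\<^bsub>V\<^esub> (T v \<ominus>\<^bsub>V\<^esub> c \<odot>\<^bsub>V\<^esub> v)"
      using c by (simp add: V.module.smult_r_distr V.module.M.minus_eq V.module.smult_r_minus V.module.R.m_comm flip: V.module.smult_assoc1)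
  qed (use c in auto)
qed

text \<open>The kernel of \<open>T - c\<close> consists of the solutions of
  \<open>T v = c v\<close>. This form lets injectivity be traded for surjectivity.\<close>

lemma eigenvalue_on_iff_not_inj:
  assumes "linear_map K V V T" and c: "c \<in> carrier K"
  shows "eigenvalue_on V T c \<longleftrightarrow> \<not> inj_on (\<lambda>v. T v \<ominus>\<^bsub>V\<^esub> c \<odot>\<^bsub>V\<^esub> v) (carrier V)"
proof -
  interpret T: linear_map K V V T by fact
  interpret S: linear_map K V V "\<lambda>v. T v \<ominus>\<^bsub>V\<^esub> c \<odot>\<^bsub>V\<^esub> v"
    by (rule linear_map_minus_scalar [OF assms])
  have eq: "T v \<ominus>\<^bsub>V\<^esub> c \<odot>\<^bsub>V\<^esub> v = \<zero>\<^bsub>V\<^esub> \<longleftrightarrow> T v = c \<odot>\<^bsub>V\<^esub> v" if "v \<in> carrier V" for v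
    using that c by auto
  show ?thesis
    unfolding S.Ke0_iff_inj eigenvalue_on_def
    using eq T.V.module.M.zero_closed T.f0_is_0 S.f0_is_0 by (auto simp: S.ker_def)
qed

text \<open>A preimage of an eigenvector need not be an eigenvector, so none is lifted. Instead,
  surjectivity of \<open>S - c\<close> descends along \<open>p\<close>.\<close>

lemma eigenvalue_on_lift:
  assumes W: "linear_map K W W S" and V: "linear_map K V V T"
    and p: "linear_map K W V p" and surj: "p ` carrier W = carrier V"
    and fd: "vectorspace.fin_dim K W"
    and comm: "\<And>w. w \<in> carrier W \<Longrightarrow> p (S w) = T (p w)"
    and c: "c \<in> carrier K" and ev: "eigenvalue_on V T c"
  shows "eigenvalue_on W S c"
proof (rule ccontr)
  interpret p: linear_map K W V p by (rule p)
  interpret S: linear_map K W W S by (rule W)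
  let ?S = "\<lambda>w. S w \<ominus>\<^bsub>W\<^esub> c \<odot>\<^bsub>W\<^esub> w" and ?T = "\<lambda>v. T v \<ominus>\<^bsub>V\<^esub> c \<odot>\<^bsub>V\<^esub> v"
  assume "\<not> eigenvalue_on W S c"
  then have "?S ` carrier W = carrier W"
    using linear_endomorphism_inj_imp_surj [OF linear_map_minus_scalar [OF W c] fd]
      eigenvalue_on_iff_not_inj [OF W c] by simp
  then have "carrier V = p ` ?S ` carrier W"
    using surj by simp
  \<comment> \<open>Since \<open>p\<close> is linear and carries \<open>S\<close> to
    \<open>T\<close>, it carries \<open>?S\<close> to \<open>?T\<close>.\<close>
  also have "\<dots> = ?T ` p ` carrier W"
    unfolding image_image using c by (intro image_cong) (auto simp: comm)
  finally have "?T ` carrier V = carrier V"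
    using surj by simp
  \<comment> \<open>\<open>V\<close> is finite-dimensional as the image of \<open>W\<close> under
    \<open>p\<close>.\<close>
  then show False
    using linear_endomorphism_surj_imp_inj [OF linear_map_minus_scalar [OF V c]
        p.surj_fin_dim [OF fd surj]] eigenvalue_on_iff_not_inj [OF V c] ev by simp
qed

lemma linear_map_comp:
  assumes "linear_map K U V f" and "linear_map K V W g"
  shows "linear_map K U W (\<lambda>u. g (f u))"
proof -
  interpret f: linear_map K U V f by fact
  interpret g: linear_map K V W g by fact
  show ?thesis by unfold_locales (auto simp: module_hom_def)
qed

section \<open>Subgroups of finite index\<close>

text \<open>Schreier's argument: if \<open>R\<close> meets every right coset of \<open>H\<close>, the elements \<open>t s u\<^sup>-\<^sup>1 \<in> H\<close> with
  \<open>t, u \<in> R\<close> and \<open>s\<close> a generator or its inverse generate a subgroup \<open>K\<close> with \<open>R G \<subseteq> K R\<close>.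
  Adding \<open>H \<inter> R\<close> to them replaces the usual normalization of \<open>R\<close>.\<close>

lemma (in group) finitely_generated_finite_index:
  assumes fg: "finitely_generated G" and H: "subgroup H G" and fin: "finite (rcosets H)"
  shows "finitely_generated (G\<lparr>carrier := H\<rparr>)"
proof -
  obtain S where S: "finite S" "S \<subseteq> carrier G" "generate G S = carrier G"
    using fg by (auto simp: finitely_generated_def)
  have HG: "H \<subseteq> carrier G" using H by (rule subgroup.subset)
  define rep where "rep C = (SOME t. t \<in> carrier G \<and> C = H #> t)" for C
  have rep: "rep C \<in> carrier G" "H #> rep C = C" if "C \<in> rcosets H" for C
  proof -
    have "\<exists>t. t \<in> carrier G \<and> C = H #> t" using that by (auto simp: RCOSETS_def)
    then have "rep C \<in> carrier G \<and> C = H #> rep C" unfolding rep_def by (rule someI_ex)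
    then show "rep C \<in> carrier G" "H #> rep C = C" by simp_all
  qed
  \<comment> \<open>\<open>\<one>\<close> is inserted so that \<open>trans\<close> can be started at
    \<open>t = \<one>\<close>; the representative chosen for \<open>H\<close> itself may be another
    element.\<close>
  define R where "R = insert \<one> (rep ` (rcosets H))"
  have R: "finite R" "R \<subseteq> carrier G" "\<one> \<in> R"
    using fin rep(1) by (auto simp: R_def)
  have cover: "\<exists>t\<in>R. g \<otimes> inv t \<in> H" if g: "g \<in> carrier G" for g
  proof -
    have C: "H #> g \<in> rcosets H" using g HG by (rule rcosetsI [rotated])
    have "g \<in> H #> g" by (rule rcos_self [OF g H])
    then have "g \<in> H #> rep (H #> g)" by (simp only: rep(2) [OF C])
    then have "g \<otimes> inv (rep (H #> g)) \<in> H"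
      by (rule subgroup.rcos_module_imp [OF H is_group rep(1) [OF C]])
    moreover have "rep (H #> g) \<in> R" using C by (simp add: R_def)
    ultimately show ?thesis by blast
  qed
  define S' where "S' = S \<union> m_inv G ` S"
  define Y where "Y = H \<inter> (R \<union> (\<lambda>(t, s, u). t \<otimes> s \<otimes> inv u) ` (R \<times> S' \<times> R))"
  have S'G: "S' \<subseteq> carrier G" using S by (auto simp: S'_def)
  have Y: "finite Y" "Y \<subseteq> H" "Y \<subseteq> carrier G"
    using R S HG by (auto simp: Y_def S'_def)
  let ?K = "generate G Y"
  have KH: "?K \<subseteq> H" by (rule generate_subgroup_incl [OF Y(2) H])
  have KG: "k \<in> carrier G" if "k \<in> ?K" for k using that KH HG by blast
  \<comment> \<open>With \<open>u\<close> in \<open>R\<close> representing the coset of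
    \<open>t \<otimes> s\<close>, the element \<open>t \<otimes> s \<otimes> inv u\<close> is one of
    those collected in \<open>Y\<close>.\<close>
  have step: "\<exists>k\<in>?K. \<exists>u\<in>R. t \<otimes> s = k \<otimes> u" if t: "t \<in> R" and s: "s \<in> S'" for t s
  proof -
    have tG: "t \<in> carrier G" and sG: "s \<in> carrier G" using t s R S'G by auto
    obtain u where u: "u \<in> R" "t \<otimes> s \<otimes> inv u \<in> H" using cover [of "t \<otimes> s"] tG sG by auto
    then have "t \<otimes> s \<otimes> inv u \<in> Y" using t s by (force simp: Y_def)
    then have "t \<otimes> s \<otimes> inv u \<in> ?K" by (rule generate.incl)
    moreover have "t \<otimes> s = (t \<otimes> s \<otimes> inv u) \<otimes> u"
      using tG sG u R by (simp add: m_assoc subsetD)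
    ultimately show ?thesis using u by blast
  qed
  \<comment> \<open>All \<open>t\<close> are treated at once because, for a product, the hypothesis
    on \<open>h\<close> is applied at the \<open>u\<close> that \<open>g\<close> leaves
    behind.\<close>
  have trans: "\<forall>t\<in>R. \<exists>k\<in>?K. \<exists>u\<in>R. t \<otimes> g = k \<otimes> u" if "g \<in> generate G S" for g
    using that
  proof induction
    case one
    then show ?case using R by (force intro: generate.one)
  next
    case (incl h)
    then show ?case using step by (auto simp: S'_def)
  next
    case (inv h)
    then show ?case using step by (auto simp: S'_def)
  next
    case (eng g h)
    have gh: "g \<in> carrier G" "h \<in> carrier G" using eng S by auto
    show ?case
    proof
      fix t assume t: "t \<in> R"
      obtain k u where u: "k \<in> ?K" "u \<in> R" "t \<otimes> g = k \<otimes> u" using eng t by blast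
      obtain k' u' where u': "k' \<in> ?K" "u' \<in> R" "u \<otimes> h = k' \<otimes> u'" using eng u by blast
      have "t \<otimes> (g \<otimes> h) = (k \<otimes> u) \<otimes> h"
        using t R gh by (simp add: m_assoc subsetD flip: u(3))
      also have "\<dots> = (k \<otimes> k') \<otimes> u'"
        using u u' R gh KG by (simp add: m_assoc subsetD)
      finally show "\<exists>k\<in>?K. \<exists>u\<in>R. t \<otimes> (g \<otimes> h) = k \<otimes> u"
        using u'(2) generate.eng [OF u(1) u'(1)] by blast
    qed
  qed
  have key: "\<exists>k\<in>?K. \<exists>u\<in>R. g = k \<otimes> u" if g: "g \<in> carrier G" for g
    using bspec [OF trans R(3), of g] g by (simp add: S(3))
  \<comment> \<open>In \<open>h = k \<otimes> u\<close> both \<open>h\<close> and \<open>k\<close>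
    lie in \<open>H\<close>, hence so does \<open>u\<close>. Thus \<open>u\<close> is in
    \<open>H \<inter> R\<close>, which was put into \<open>Y\<close> for this purpose.\<close>
  have "h \<in> ?K" if h: "h \<in> H" for h
  proof -
    obtain k u where u: "k \<in> ?K" "u \<in> R" "h = k \<otimes> u" using key h HG by blast
    have "k \<in> H" using u KH by blast
    then have "inv k \<otimes> h \<in> H" using h H by (simp add: subgroup.m_closed subgroup.m_inv_closed)
    moreover have "inv k \<otimes> h = u"
      unfolding u(3) using KG [OF u(1)] u(2) R(2) by (auto simp flip: m_assoc)
    ultimately have "u \<in> H" by simp
    then have "u \<in> ?K" using u by (intro generate.incl) (simp add: Y_def)
    then show ?thesis unfolding u(3) by (rule generate.eng [OF u(1)])
  qed
  then have "generate (G\<lparr>carrier := H\<rparr>) Y = H"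
    using KH generate_consistent [OF Y(2) H] by auto
  then show ?thesis
    using Y by (auto simp: finitely_generated_def)
qed

text \<open>Pigeonhole: two powers \<open>g [^] m\<close> and \<open>g [^] n\<close> with
  \<open>m < n\<close> share a coset, and their quotient is \<open>g [^] (n - m)\<close>.\<close>

lemma (in group) finite_index_pow_mem:
  assumes H: "subgroup H G" and fin: "finite (rcosets H)" and g: "g \<in> carrier G"
  shows "\<exists>n>0. g [^] (n::nat) \<in> H"
proof -
  have "(\<lambda>n::nat. H #> g [^] n) ` UNIV \<subseteq> rcosets H"
    using g H by (auto intro!: rcosetsI dest: subgroup.subset)
  then have "\<not> inj (\<lambda>n::nat. H #> g [^] n)"
    using fin finite_imageD finite_subset infinite_UNIV_nat by blast
  then obtain m n where "m < n" and eq: "H #> g [^] m = H #> g [^] (n::nat)"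
    using linorder_inj_onI' [of UNIV "\<lambda>n. H #> g [^] (n::nat)"] by blast
  have "g [^] n \<in> H #> g [^] m"
    unfolding eq using g H by (intro rcos_self) auto
  then have "g [^] n \<otimes> inv (g [^] m) \<in> H"
    using g H by (intro subgroup.rcos_module_imp) auto
  moreover have "g [^] n = g [^] (n - m) \<otimes> g [^] m"
    using \<open>m < n\<close> g by (simp add: nat_pow_mult)
  ultimately have "g [^] (n - m) \<in> H"
    using g by (simp add: m_assoc)
  with \<open>m < n\<close> show ?thesis by (intro exI [of _ "n - m"]) simp
qed

section \<open>Generators of the abelianization\<close>

lemma finitely_generated_abelianization:
  assumes "group G" and "finitely_generated G"
  shows "finitely_generated (abelianization G)"
proof -
  interpret group G by fact
  let ?D = "derived G (carrier G)"
  obtain S where S: "finite S" "S \<subseteq> carrier G" "generate G S = carrier G"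
    using assms by (auto simp: finitely_generated_def)
  interpret D: normal ?D G
    by (rule derived_self_is_normal)
  interpret h: group_hom G "abelianization G" "\<lambda>a. ?D #>\<^bsub>G\<^esub> a"
    unfolding abelianization_def group_hom_def group_hom_axioms_def
    by (simp add: D.factorgroup_is_group D.r_coset_hom_Mod)
  have "generate (abelianization G) ((\<lambda>a. ?D #>\<^bsub>G\<^esub> a) ` S) = carrier (abelianization G)"
    using h.generate_img [OF S(2)] by (simp add: S(3) abelianization_def carrier_FactGroup)
  then show ?thesis
    unfolding finitely_generated_def
    using S by (intro exI [of _ "(\<lambda>a. ?D #>\<^bsub>G\<^esub> a) ` S"]) auto
qed

section \<open>Complexification as a functor to vector spaces\<close>

lemma field_complex_ring: "field complex_ring"
proof -
  interpret cring complex_ring by (rule cring_complex_ring)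
  have "Units complex_ring = carrier complex_ring - {\<zero>\<^bsub>complex_ring\<^esub>}"
  proof -
    have "\<exists>y. y * x = 1 \<and> x * y = 1" if "x \<noteq> 0" for x :: complex
      using that by (intro exI [of _ "inverse x"]) simp
    then show ?thesis by (auto simp: Units_def complex_ring_def)
  qed
  then show ?thesis by (rule cring_fieldI)
qed

lemma vectorspace_complexification:
  assumes "comm_group A"
  shows "vectorspace complex_ring (complexification A)"
  using module_complexification [OF assms] field_complex_ring by (simp add: vectorspace_def)

text \<open>The class of an arbitrary formal sum of pairs, so that computations can be done on
  representatives; pure tensors are the classes of single pairs.\<close>

definition tensor_coset ::
  "('a, 'm) monoid_scheme \<Rightarrow> ('a \<times> complex \<Rightarrow>\<^sub>0 int) \<Rightarrow> ('a \<times> complex \<Rightarrow>\<^sub>0 int) set" where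
  "tensor_coset A x =
     tensor_kernel A complex_group
       #>\<^bsub>free_Abelian_group (carrier A \<times> carrier complex_group)\<^esub> x"

lemma pure_tensor_eq_tensor_coset:
  "pure_tensor A complex_group a z = tensor_coset A (frag_of (a, z))"
  by (simp add: pure_tensor_def tensor_coset_def)

section \<open>Arithmetic of cosets and pure tensors\<close>

context
  fixes A :: "('a, 'm) monoid_scheme"
  assumes A: "comm_group A"
begin

interpretation A: comm_group A by (rule A)
interpretation C: comm_group complex_group by (rule comm_group_complex_group)
interpretation V: vectorspace complex_ring "complexification A"
  by (rule vectorspace_complexification [OF A])

abbreviation (input) free_pairs where "free_pairs \<equiv> free_Abelian_group (carrier A \<times> carrier complex_group)"

lemma normal_tensor_kernel: "tensor_kernel A complex_group \<lhd> free_pairs"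
  by (intro comm_group.subgroup_imp_normal abelian_free_Abelian_group subgroup_tensor_kernel)
    (rule A.is_group C.is_group)+

lemma carrier_complexification:
  "carrier (complexification A) = tensor_coset A ` carrier free_pairs"
  by (simp add: complexification_def tensor_def carrier_FactGroup tensor_coset_def image_image)

lemma tensor_coset_add:
  assumes "x \<in> carrier free_pairs" "y \<in> carrier free_pairs"
  shows "tensor_coset A (x + y) = tensor_coset A x \<oplus>\<^bsub>complexification A\<^esub> tensor_coset A y"
  using normal.rcos_sum [OF normal_tensor_kernel assms]
  by (simp add: complexification_def tensor_def tensor_coset_def)

lemma tensor_coset_zero: "tensor_coset A 0 = \<zero>\<^bsub>complexification A\<^esub>"
proof -
  have "tensor_kernel A complex_group #>\<^bsub>free_pairs\<^esub> \<one>\<^bsub>free_pairs\<^esub> = tensor_kernel A complex_group"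
    using normal_imp_subgroup [OF normal_tensor_kernel]
    by (intro group.coset_mult_one group_free_Abelian_group subgroup.subset)
  then show ?thesis
    by (simp add: complexification_def tensor_def tensor_coset_def)
qed

text \<open>Serves \<open>frag_induction\<close>, which builds formal sums by differences. It
  follows from additivity applied to \<open>x = (x - y) + y\<close>.\<close>

lemma tensor_coset_diff:
  assumes x: "x \<in> carrier free_pairs" and y: "y \<in> carrier free_pairs"
  shows "tensor_coset A (x - y) = tensor_coset A x \<ominus>\<^bsub>complexification A\<^esub> tensor_coset A y"
proof -
  have xy: "x - y \<in> carrier free_pairs"
    using x y keys_diff [of x y] by auto
  have c: "tensor_coset A u \<in> carrier (complexification A)" if "u \<in> carrier free_pairs" for u
    using that by (simp add: carrier_complexification del: carrier_free_Abelian_group_iff)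
  have "tensor_coset A x \<ominus>\<^bsub>complexification A\<^esub> tensor_coset A y =
      tensor_coset A (x - y) \<oplus>\<^bsub>complexification A\<^esub> tensor_coset A y
        \<ominus>\<^bsub>complexification A\<^esub> tensor_coset A y"
    using tensor_coset_add [OF xy y] by simp
  also have "\<dots> = tensor_coset A (x - y)"
    using c [OF y] c [OF xy]
    by (simp add: V.module.M.minus_eq V.module.M.a_assoc V.module.M.r_neg
        del: carrier_free_Abelian_group_iff)
  finally show ?thesis by (rule sym)
qed

lemma pure_tensor_closed:
  "a \<in> carrier A \<Longrightarrow> pure_tensor A complex_group a z \<in> carrier (complexification A)"
  unfolding pure_tensor_eq_tensor_coset carrier_complexification
  by (rule imageI) (simp add: complex_group_def)

lemma smult_pure_tensor:
  assumes "a \<in> carrier A"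
  shows "c \<odot>\<^bsub>complexification A\<^esub> pure_tensor A complex_group a z =
    pure_tensor A complex_group a (c * z)"
  unfolding complexification_def
  using assms
  by (simp, intro tensor_map_pure)
    (auto simp: hom_def complex_group_def algebra_simps A.is_group
      C.is_group [unfolded complex_group_def])

lemma smult_tensor_coset:
  assumes "x \<in> carrier free_pairs"
  shows "c \<odot>\<^bsub>complexification A\<^esub> tensor_coset A x =
    tensor_coset A (frag_extend (\<lambda>(a, z). frag_of (a, c * z)) x)"
proof -
  have "(*) c \<in> hom complex_group complex_group"
    by (auto simp: hom_def complex_group_def algebra_simps)
  moreover have "(\<lambda>a. a) \<in> hom A A" by (auto simp: hom_def)
  ultimately show ?thesis
    using tensor_map_coset [OF A.is_group C.is_group A.is_group C.is_group _ _ assms]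
    by (simp add: complexification_def tensor_coset_def)
qed

text \<open>The difference of the two representatives is a defining tensor relation, so it lies in
  the kernel and the cosets coincide.\<close>

lemma pure_tensor_mult:
  assumes "a \<in> carrier A" "b \<in> carrier A"
  shows "pure_tensor A complex_group (a \<otimes>\<^bsub>A\<^esub> b) z =
    pure_tensor A complex_group a z \<oplus>\<^bsub>complexification A\<^esub> pure_tensor A complex_group b z"
proof -
  let ?K = "tensor_kernel A complex_group"
  have K: "subgroup ?K free_pairs"
    by (rule normal_imp_subgroup [OF normal_tensor_kernel])
  let ?x = "frag_of (a \<otimes>\<^bsub>A\<^esub> b, z)" and ?y = "frag_of (a, z) + frag_of (b, z)"
  have "?x - frag_of (a, z) - frag_of (b, z) \<in> tensor_relations A complex_group"
    unfolding tensor_relations_def using assms by (auto simp: complex_group_def)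
  then have k: "?x - ?y \<in> ?K"
    unfolding tensor_kernel_def by (simp add: diff_diff_add generate.incl)
  have c: "frag_of (a, z) \<in> carrier free_pairs" "frag_of (b, z) \<in> carrier free_pairs"
    using assms by (auto simp: complex_group_def)
  have y: "?y \<in> carrier free_pairs"
    using assms keys_add [of "frag_of (a, z)" "frag_of (b, z)"] by (auto simp: complex_group_def)
  have "?x \<in> ?K #>\<^bsub>free_pairs\<^esub> ?y"
    using k by (auto simp: r_coset_def intro!: bexI [of _ "?x - ?y"])
  then have "tensor_coset A ?x = tensor_coset A ?y"
    unfolding tensor_coset_def
    using group.repr_independence [OF group_free_Abelian_group _ y K] by simp
  also have "\<dots> = tensor_coset A (frag_of (a, z)) \<oplus>\<^bsub>complexification A\<^esub> tensor_coset A (frag_of (b, z))"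
    by (rule tensor_coset_add [OF c])
  finally show ?thesis by (simp add: pure_tensor_eq_tensor_coset)
qed

text \<open>For \<open>u\<close> the left-hand side, \<open>pure_tensor_mult\<close> gives
  \<open>u = u + u\<close>, and \<open>u\<close> cancels.\<close>

lemma pure_tensor_one: "pure_tensor A complex_group \<one>\<^bsub>A\<^esub> z = \<zero>\<^bsub>complexification A\<^esub>"
  using pure_tensor_mult [of "\<one>\<^bsub>A\<^esub>" "\<one>\<^bsub>A\<^esub>" z] pure_tensor_closed [of "\<one>\<^bsub>A\<^esub>" z] by simp

lemma pure_tensor_inv:
  assumes "a \<in> carrier A"
  shows "pure_tensor A complex_group (inv\<^bsub>A\<^esub> a) z =
    \<ominus>\<^bsub>complexification A\<^esub> pure_tensor A complex_group a z"
  using pure_tensor_mult [of "inv\<^bsub>A\<^esub> a" a z] pure_tensor_one assms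
  by (simp add: V.module.M.minus_equality pure_tensor_closed)

text \<open>This is distributivity of scalars at \<open>a \<otimes> 1\<close>, since
  \<open>y\<close> times \<open>a \<otimes> 1\<close> is \<open>a \<otimes> y\<close>.\<close>

lemma pure_tensor_add:
  assumes a: "a \<in> carrier A"
  shows "pure_tensor A complex_group a (y + z) =
    pure_tensor A complex_group a y \<oplus>\<^bsub>complexification A\<^esub> pure_tensor A complex_group a z"
  using V.module.smult_l_distr [OF _ _ pure_tensor_closed [OF a], of y z 1]
  by (simp add: smult_pure_tensor [OF a]) (simp add: complex_ring_def)

text \<open>Moving exponents across the tensor sign makes division possible: \<open>a\<close> to the
  \<open>n\<close>, tensored with \<open>1 / n\<close>, is \<open>a \<otimes> 1\<close> for
  \<open>n > 0\<close>.\<close>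

lemma pure_tensor_nat_pow:
  assumes a: "a \<in> carrier A"
  shows "pure_tensor A complex_group (a [^]\<^bsub>A\<^esub> n) z = pure_tensor A complex_group a (of_nat n * z)"
proof (induction n)
  case 0
  have "pure_tensor A complex_group a 0 = \<zero>\<^bsub>complexification A\<^esub>"
    using pure_tensor_add [OF a, of 0 0] pure_tensor_closed [OF a, of 0] by simp
  then show ?case by (simp add: pure_tensor_one)
next
  case (Suc n)
  then show ?case
    using a by (simp add: pure_tensor_mult pure_tensor_add V.module.M.a_comm pure_tensor_closed distrib_right)
qed

text \<open>Every element is an integer combination of scalar multiples of tensors
  \<open>a \<otimes> 1\<close>. This is the common tool for finite dimension, surjectivity and
  equality of linear maps.\<close>

lemma submodule_complexification_eq:
  assumes N: "submodule complex_ring N (complexification A)"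
    and pure: "\<And>a. a \<in> carrier A \<Longrightarrow> pure_tensor A complex_group a 1 \<in> N"
  shows "N = carrier (complexification A)"
proof
  show "N \<subseteq> carrier (complexification A)" by (rule submodule.subset [OF N])
  \<comment> \<open>Membership in \<open>free_pairs\<close> is carried along because the induction
    hypotheses of the difference case must supply it to \<open>tensor_coset_diff\<close>.\<close>
  have "x \<in> carrier free_pairs \<and> tensor_coset A x \<in> N"
    if "Poly_Mapping.keys x \<subseteq> carrier A \<times> carrier complex_group" for x
    using that
  proof (induction x rule: frag_induction)
    case zero
    then show ?case using submodule.zero_closed [OF N] by (simp add: tensor_coset_zero)
  next
    case (one s)
    obtain a z where s: "s = (a, z)" "a \<in> carrier A" using one by (cases s) auto
    have "z \<odot>\<^bsub>complexification A\<^esub> pure_tensor A complex_group a 1 \<in> N"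
      using submodule.smult_closed [OF N _ pure [OF s(2)]] by (simp add: complex_ring_def)
    then show ?case
      using s one by (simp add: smult_pure_tensor flip: pure_tensor_eq_tensor_coset)
  next
    case (diff x y)
    then have xy: "x \<in> carrier free_pairs" "y \<in> carrier free_pairs"
      and N': "tensor_coset A x \<in> N" "tensor_coset A y \<in> N" by blast+
    \<comment> \<open>Closure under negation is obtained as multiplication by the scalar
      \<open>-1\<close>.\<close>
    have "(\<ominus>\<^bsub>complex_ring\<^esub> \<one>\<^bsub>complex_ring\<^esub>) \<odot>\<^bsub>complexification A\<^esub> tensor_coset A y \<in> N"
      by (rule submodule.smult_closed [OF N _ N'(2)]) simp
    then have "tensor_coset A x \<ominus>\<^bsub>complexification A\<^esub> tensor_coset A y \<in> N"
      using submodule.m_closed [OF N N'(1)] submodule.subset [OF N] N'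
      by (simp add: V.module.smult_minus_1 V.module.M.minus_eq subsetD)
    moreover have "x - y \<in> carrier free_pairs"
      using xy keys_diff [of x y] by auto
    ultimately show ?case
      by (simp only: tensor_coset_diff [OF xy] simp_thms)
  qed
  then show "carrier (complexification A) \<subseteq> N"
    by (auto simp: carrier_complexification)
qed

text \<open>The elements \<open>a\<close> with \<open>a \<otimes> 1\<close> in the span contain the
  generators and are closed under the group operations, so they exhaust \<open>A\<close>.\<close>

lemma fin_dim_complexification:
  assumes "finitely_generated A"
  shows "vectorspace.fin_dim complex_ring (complexification A)"
proof -
  obtain S where S: "finite S" "S \<subseteq> carrier A" "generate A S = carrier A"
    using assms by (auto simp: finitely_generated_def)
  let ?B = "(\<lambda>a. pure_tensor A complex_group a 1) ` S"
  have B: "?B \<subseteq> carrier (complexification A)"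
    using S pure_tensor_closed by auto
  let ?N = "V.module.span ?B"
  have N: "submodule complex_ring ?N (complexification A)"
    by (rule V.module.span_is_submodule [OF B])
  have inN: "pure_tensor A complex_group a 1 \<in> ?N" if "a \<in> S" for a
    using that V.module.in_own_span [OF B] by auto
  have "pure_tensor A complex_group a 1 \<in> ?N" if "a \<in> generate A S" for a
    using that
  proof induction
    case one
    then show ?case using submodule.zero_closed [OF N] by (simp add: pure_tensor_one)
  next
    case (incl a)
    then show ?case by (rule inN)
  next
    case (inv a)
    then have "(\<ominus>\<^bsub>complex_ring\<^esub> \<one>\<^bsub>complex_ring\<^esub>) \<odot>\<^bsub>complexification A\<^esub> pure_tensor A complex_group a 1 \<in> ?N"
      by (intro submodule.smult_closed [OF N] inN) auto
    then show ?case
      using inv S by (simp add: pure_tensor_inv pure_tensor_closed V.module.smult_minus_1 subsetD)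
  next
    case (eng a b)
    then show ?case
      using S submodule.m_closed [OF N] by (simp add: pure_tensor_mult)
  qed
  then have "?N = carrier (complexification A)"
    by (intro submodule_complexification_eq N) (simp add: S)
  then show ?thesis
    unfolding V.fin_dim_def using S B by blast
qed

end

text \<open>\<open>complexification_map\<close> has the same body but is typed for endomorphisms;
  the inclusion of a subgroup needs separate source and target, since the abelianizations
  differ.\<close>

abbreviation (input) complexify ::
  "('b, 'n) monoid_scheme \<Rightarrow> ('a \<Rightarrow> 'b) \<Rightarrow> ('a \<times> complex \<Rightarrow>\<^sub>0 int) set \<Rightarrow> ('b \<times> complex \<Rightarrow>\<^sub>0 int) set"
  where "complexify B f \<equiv> tensor_map B complex_group f (\<lambda>z. z)"

section \<open>Functoriality of complexification\<close>

context
  fixes A :: "('a, 'm) monoid_scheme" and B :: "('b, 'n) monoid_scheme" and f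
  assumes A: "comm_group A" and B: "comm_group B" and f: "f \<in> hom A B"
begin

interpretation A: comm_group A by (rule A)
interpretation B: comm_group B by (rule B)
interpretation C: comm_group complex_group by (rule comm_group_complex_group)

lemma id_hom_complex: "(\<lambda>z. z) \<in> hom complex_group complex_group"
  by (auto simp: hom_def)

lemma complexify_tensor_coset:
  assumes "x \<in> carrier (free_Abelian_group (carrier A \<times> carrier complex_group))"
  shows "complexify B f (tensor_coset A x) =
    tensor_coset B (frag_extend (\<lambda>(a, z). frag_of (f a, z)) x)"
  unfolding tensor_coset_def
  by (rule tensor_map_coset [OF A.is_group C.is_group B.is_group C.is_group f id_hom_complex assms])

lemma complexify_pure_tensor:
  "a \<in> carrier A \<Longrightarrow>
    complexify B f (pure_tensor A complex_group a z) = pure_tensor B complex_group (f a) z"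
  by (rule tensor_map_pure [OF A.is_group C.is_group B.is_group C.is_group f id_hom_complex])
    (auto simp: complex_group_def)

lemma linear_map_complexify:
  "linear_map complex_ring (complexification A) (complexification B) (complexify B f)"
proof -
  interpret VA: vectorspace complex_ring "complexification A"
    by (rule vectorspace_complexification [OF A])
  interpret VB: vectorspace complex_ring "complexification B"
    by (rule vectorspace_complexification [OF B])
  let ?FA = "free_Abelian_group (carrier A \<times> carrier complex_group)"
  let ?FB = "free_Abelian_group (carrier B \<times> carrier complex_group)"
  let ?E = "frag_extend (\<lambda>(a, z). frag_of (f a, z))"
  have E: "?E \<in> hom ?FA ?FB"
    using f by (intro frag_extend_in_hom) (auto simp: hom_def)
  have Ec: "?E x \<in> carrier ?FB" if "x \<in> carrier ?FA" for x
    using E that by (rule hom_in_carrier)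
  have cl: "complexify B f v \<in> carrier (complexification B)" if "v \<in> carrier (complexification A)" for v
    using that Ec
    by (auto simp: carrier_complexification [OF A] carrier_complexification [OF B]
        complexify_tensor_coset simp del: carrier_free_Abelian_group_iff)
  have add: "complexify B f (v \<oplus>\<^bsub>complexification A\<^esub> w) =
      complexify B f v \<oplus>\<^bsub>complexification B\<^esub> complexify B f w"
    if vw: "v \<in> carrier (complexification A)" "w \<in> carrier (complexification A)" for v w
  proof -
    obtain x y where x: "v = tensor_coset A x" "x \<in> carrier ?FA"
      and y: "w = tensor_coset A y" "y \<in> carrier ?FA"
      using vw unfolding carrier_complexification [OF A] by blast
    have xy: "x + y \<in> carrier ?FA"
      using x y keys_add [of x y] by auto
    have "complexify B f (tensor_coset A (x + y)) = tensor_coset B (?E x + ?E y)"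
      by (simp only: complexify_tensor_coset [OF xy] frag_extend_add)
    then show ?thesis
      by (simp only: x y tensor_coset_add [OF A x(2) y(2)] tensor_coset_add [OF B Ec Ec]
          complexify_tensor_coset)
  qed
  have smult: "complexify B f (c \<odot>\<^bsub>complexification A\<^esub> v) =
      c \<odot>\<^bsub>complexification B\<^esub> complexify B f v"
    if v: "v \<in> carrier (complexification A)" for c v
  proof -
    obtain x where x: "v = tensor_coset A x" "x \<in> carrier ?FA"
      using v unfolding carrier_complexification [OF A] by blast
    have M: "frag_extend (\<lambda>(a, z). frag_of (a, c * z)) x \<in> carrier ?FA"
      by (rule hom_in_carrier [OF _ x(2)], rule frag_extend_in_hom) (auto simp: complex_group_def)
    \<comment> \<open>The two substitutions act on different coordinates; in either order their
      composite sends \<open>(a, z)\<close> to \<open>(f a, c * z)\<close>.\<close>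
    have "?E (frag_extend (\<lambda>(a, z). frag_of (a, c * z)) x) =
        frag_extend (\<lambda>(a, z). frag_of (a, c * z)) (?E x)"
      using frag_extend_compose [of "\<lambda>(a, z). frag_of (f a, z)" "\<lambda>(a, z). (a, c * z)" x]
        frag_extend_compose [of "\<lambda>(a, z). frag_of (a, c * z)" "\<lambda>(a, z). (f a, z)" x]
      by (simp add: comp_def case_prod_unfold)
    then show ?thesis
      by (simp only: x(1) smult_tensor_coset [OF A x(2)] smult_tensor_coset [OF B Ec [OF x(2)]]
          complexify_tensor_coset [OF M] complexify_tensor_coset [OF x(2)])
  qed
  show ?thesis
    by unfold_locales (auto simp: module_hom_def cl add smult)
qed

end

text \<open>The equalizer of two linear maps is a submodule, and here it contains all
  \<open>a \<otimes> 1\<close>.\<close>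

lemma complexify_eqI:
  assumes A: "comm_group A" and B: "comm_group B"
    and f: "linear_map complex_ring (complexification A) (complexification B) f"
    and g: "linear_map complex_ring (complexification A) (complexification B) g"
    and eq: "\<And>a. a \<in> carrier A \<Longrightarrow>
      f (pure_tensor A complex_group a 1) = g (pure_tensor A complex_group a 1)"
    and v: "v \<in> carrier (complexification A)"
  shows "f v = g v"
proof -
  interpret f: linear_map complex_ring "complexification A" "complexification B" f by (rule f)
  interpret g: linear_map complex_ring "complexification A" "complexification B" g by (rule g)
  have "submodule complex_ring {v \<in> carrier (complexification A). f v = g v} (complexification A)"
    by (rule submodule.intro) (use f.V.module.module_axioms in auto)
  then have "{v \<in> carrier (complexification A). f v = g v} = carrier (complexification A)"
    by (rule submodule_complexification_eq [OF A]) (simp add: eq pure_tensor_closed [OF A])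
  with v show ?thesis by blast
qed

section \<open>Maps induced on abelianizations\<close>

text \<open>The counterpart of \<open>abelianization_map\<close> for a homomorphism between two
  groups, as needed for the inclusion.\<close>

abbreviation (input) abelianize ::
  "('b, 'n) monoid_scheme \<Rightarrow> ('a \<Rightarrow> 'b) \<Rightarrow> 'a set \<Rightarrow> 'b set"
  where "abelianize H f \<equiv> quotient_map H (derived H (carrier H)) f"

context
  fixes G :: "('a, 'm) monoid_scheme" and H :: "('b, 'n) monoid_scheme" and f
  assumes G: "group G" and H: "group H" and f: "f \<in> hom G H"
begin

interpretation group_hom G H f
  using G H f by (simp add: group_hom_def group_hom_axioms_def)

lemma derived_image_subset_derived:
  "f ` derived G (carrier G) \<subseteq> derived H (carrier H)"
proof -
  have "f ` carrier G \<subseteq> carrier H" by auto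
  then show ?thesis
    using derived_img [of "carrier G"] H.mono_derived by (metis order_refl)
qed

lemma abelianize_coset:
  assumes "g \<in> carrier G"
  shows "abelianize H f (derived G (carrier G) #>\<^bsub>G\<^esub> g) = derived H (carrier H) #>\<^bsub>H\<^esub> f g"
  using f G H _ _ derived_image_subset_derived assms
  by (rule quotient_map_coset)
    (intro G.derived_is_subgroup H.derived_is_subgroup order_refl)+

lemma hom_abelianize: "abelianize H f \<in> hom (abelianization G) (abelianization H)"
proof -
  interpret DG: normal "derived G (carrier G)" G by (rule G.derived_self_is_normal)
  interpret DH: normal "derived H (carrier H)" H by (rule H.derived_self_is_normal)
  show ?thesis
    unfolding abelianization_def
    by (rule homI) (auto simp: carrier_FactGroup abelianize_coset DG.rcos_sum DH.rcos_sum)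
qed

end

lemma carrier_abelianization:
  "carrier (abelianization G) = (\<lambda>g. derived G (carrier G) #>\<^bsub>G\<^esub> g) ` carrier G"
  by (simp add: abelianization_def carrier_FactGroup)

text \<open>Each \<open>g\<close> has a power \<open>g\<^sup>n\<close> in \<open>H\<close> with \<open>n > 0\<close>, and the class of \<open>g\<close> is \<open>1/n\<close> times that
  of \<open>g\<^sup>n\<close>, so it lies in the image.\<close>

lemma surj_complexify_finite_index:
  assumes "group G" and H: "subgroup H G" and fin: "finite (rcosets\<^bsub>G\<^esub> H)"
  shows "complexify (abelianization G) (abelianize G (\<lambda>x. x)) `
      carrier (complexification (abelianization (G\<lparr>carrier := H\<rparr>))) =
    carrier (complexification (abelianization G))"
proof -
  interpret G: group G by fact
  let ?H = "G\<lparr>carrier := H\<rparr>"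
  let ?A = "abelianization ?H" and ?B = "abelianization G"
  let ?D = "\<lambda>g. derived G (carrier G) #>\<^bsub>G\<^esub> g" and ?i = "abelianize G (\<lambda>x. x)"
  have H': "group ?H" by (rule G.subgroup_imp_group [OF H])
  have i: "(\<lambda>x. x) \<in> hom ?H G"
    using subgroup.subset [OF H] by (auto simp: hom_def)
  note A = comm_group_abelianization [OF H'] and B = comm_group_abelianization [OF \<open>group G\<close>]
  note ih = hom_abelianize [OF H' \<open>group G\<close> i]
  interpret L: linear_map complex_ring "complexification ?A" "complexification ?B" "complexify ?B ?i"
    by (rule linear_map_complexify [OF A B ih])
  interpret D: group_hom G ?B ?D
    using G.derived_self_is_normal
    by (simp add: abelianization_def group_hom_def group_hom_axioms_def
        normal.factorgroup_is_group normal.r_coset_hom_Mod \<open>group G\<close>)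
  \<comment> \<open>The image is a submodule, so it is enough to reach each
    \<open>a \<otimes> 1\<close>.\<close>
  have "L.im = carrier (complexification ?B)"
  proof (rule submodule_complexification_eq [OF B L.im_is_submodule])
    fix a assume "a \<in> carrier ?B"
    then obtain g where g: "g \<in> carrier G" and a: "a = ?D g"
      by (auto simp: carrier_abelianization)
    obtain n where n: "n > 0" "g [^]\<^bsub>G\<^esub> (n::nat) \<in> H"
      using G.finite_index_pow_mem [OF H fin g] by blast
    let ?h = "derived ?H (carrier ?H) #>\<^bsub>?H\<^esub> (g [^]\<^bsub>G\<^esub> n)"
    have h: "?h \<in> carrier ?A"
      using n by (simp add: carrier_abelianization)
    have "?i ?h = ?D (g [^]\<^bsub>G\<^esub> n)"
      using n by (intro abelianize_coset [OF H' \<open>group G\<close> i]) simp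
    also have "\<dots> = a [^]\<^bsub>?B\<^esub> n"
      using g by (simp add: a D.hom_nat_pow)
    finally have "complexify ?B ?i (pure_tensor ?A complex_group ?h (1 / of_nat n)) =
        pure_tensor ?B complex_group (a [^]\<^bsub>?B\<^esub> n) (1 / of_nat n)"
      by (simp only: complexify_pure_tensor [OF A B ih h])
    also have "\<dots> = pure_tensor ?B complex_group a 1"
      using n by (simp add: pure_tensor_nat_pow [OF B] \<open>a \<in> carrier ?B\<close>)
    finally show "pure_tensor ?B complex_group a 1 \<in> L.im"
      using pure_tensor_closed [OF A h] unfolding L.im_def by (metis imageI)
  qed
  then show ?thesis by (simp add: L.im_def)
qed

theorem theorem1:
  fixes F :: "('a, 'b) monoid_scheme" and \<phi> :: "'a \<Rightarrow> 'a" and H :: "'a set"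
  assumes "free_group F" and "finitely_generated F"
    and "\<phi> \<in> hom F F"
    and "subgroup H F" and "finite (rcosets\<^bsub>F\<^esub> H)"
    and "\<phi> ` H \<subseteq> H"
  shows "nonzero_eigenvalues F \<phi> \<subseteq> nonzero_eigenvalues (F\<lparr>carrier := H\<rparr>) (restrict \<phi> H)"
proof -
  let ?H = "F\<lparr>carrier := H\<rparr>" and ?\<psi> = "restrict \<phi> H"
  let ?A = "abelianization ?H" and ?B = "abelianization F"
  let ?i = "abelianize F (\<lambda>x. x)"
  have F: "group F" using assms(1) by (simp add: free_group_def)
  have H: "group ?H" by (rule group.subgroup_imp_group [OF F assms(4)])
  have HF: "H \<subseteq> carrier F" by (rule subgroup.subset [OF assms(4)])
  have i: "(\<lambda>x. x) \<in> hom ?H F"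
    using HF by (auto simp: hom_def)
  \<comment> \<open>Invariance of \<open>H\<close> under \<open>\<phi>\<close> makes the restriction
    an endomorphism of \<open>H\<close>.\<close>
  have \<psi>: "?\<psi> \<in> hom ?H ?H"
    using assms(3,6) HF subgroup.m_closed [OF assms(4)] by (auto simp: hom_def subset_iff)
  note A = comm_group_abelianization [OF H] and B = comm_group_abelianization [OF F]
  note ih = hom_abelianize [OF H F i] and \<phi>h = hom_abelianize [OF F F assms(3)]
    and \<psi>h = hom_abelianize [OF H H \<psi>]
  let ?S = "complexify ?A (abelianize ?H ?\<psi>)" and ?T = "complexify ?B (abelianize F \<phi>)"
    and ?p = "complexify ?B ?i"
  note S = linear_map_complexify [OF A A \<psi>h] and T = linear_map_complexify [OF B B \<phi>h]
    and p = linear_map_complexify [OF A B ih]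
  have fd: "vectorspace.fin_dim complex_ring (complexification ?A)"
    using group.finitely_generated_finite_index [OF F assms(2,4,5)]
    by (intro fin_dim_complexification A finitely_generated_abelianization H)
  \<comment> \<open>Both composites are linear, so they need only be compared on tensors
    \<open>a \<otimes> 1\<close>.\<close>
  have comm: "?p (?S w) = ?T (?p w)" if "w \<in> carrier (complexification ?A)" for w
  proof (rule complexify_eqI [OF A B linear_map_comp [OF S p] linear_map_comp [OF p T] _ that])
    fix a assume a: "a \<in> carrier ?A"
    then obtain h where h: "h \<in> H" "a = derived ?H (carrier ?H) #>\<^bsub>?H\<^esub> h"
      by (auto simp: carrier_abelianization)
    have \<phi>H: "\<phi> h \<in> H" using h assms(6) by blast
    \<comment> \<open>With \<open>a\<close> the class of \<open>h\<close>, both sides are the class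
      of \<open>\<phi> h\<close> in the abelianization of \<open>F\<close>.\<close>
    have "?i (abelianize ?H ?\<psi> a) = abelianize F \<phi> (?i a)"
      using abelianize_coset [OF H H \<psi>, of h] abelianize_coset [OF H F i, of h]
        abelianize_coset [OF H F i, of "\<phi> h"] abelianize_coset [OF F F assms(3), of h] h \<phi>H HF
      by (simp add: subsetD)
    then show "?p (?S (pure_tensor ?A complex_group a 1)) = ?T (?p (pure_tensor ?A complex_group a 1))"
      by (simp only: complexify_pure_tensor [OF A A \<psi>h a] complexify_pure_tensor [OF A B ih a]
          complexify_pure_tensor [OF A B ih hom_in_carrier [OF \<psi>h a]]
          complexify_pure_tensor [OF B B \<phi>h hom_in_carrier [OF ih a]])
  qed
  have ev: "eigenvalue_on (complexification ?A) ?S c"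
    if "eigenvalue_on (complexification ?B) ?T c" for c
  proof (rule eigenvalue_on_lift [OF S T p surj_complexify_finite_index [OF F assms(4,5)] fd _ _ that])
    show "c \<in> carrier complex_ring" by (simp add: complex_ring_def)
  qed (rule comm)
  \<comment> \<open>Unfolding exposes \<open>?S\<close> and \<open>?T\<close>; the condition
    \<open>c \<noteq> 0\<close> is the same on both sides, and \<open>ev\<close> transfers the
    eigenvalue.\<close>
  show ?thesis
    unfolding nonzero_eigenvalues_def complexification_map_def abelianization_map_def
    by (rule Collect_mono) (rule impI, erule conjE, rule conjI, assumption, erule ev)
qed

end
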